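(* Let $a$ and $b$ be real-valued discrete-time signals and let $n\ge1$ be a time horizon. At each time instant $k$ (with $k\ge n-1$; all quantities evaluated at $k$), $$\big|V_n^2[a+b]-V_n^2[a]-V_n^2[b]\big|\le 2\min\big\{\|\mathbf{a}_n\|_2\,V_n[b],\ \|\mathbf{b}_n\|_2\,V_n[a]\big\},$$ $$V_n[ab]\le\sqrt n\,V_n[a]\,V_n[b]+\big|\mu_n[a]\big|\,V_n[b]+\big|\mu_n[b]\big|\,V_n[a].$$
   Context: Signals are functions of discrete time $k\in\{0,1,2,\dots\}$; $a+b$ and $ab$ are the pointwise sum and product. For a real-valued signal $x$: $\mathbf{x}_n(k)=[x(k),x(k-1),\dots,x(k-n+1)]^{\intercal}\in\mathbb{R}^n$, $\mu_n[x](k)=\frac1n\sum_{i=0}^{n-1}x(k-i)$, and $V_n[x](k)\ge0$ is defined by $V_n^2[x](k)=\frac1n\sum_{i=0}^{n-1}x^2(k-i)-(\mu_n[x](k))^2$. *)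

theory Defs
  imports "HOL-Analysis.Analysis"
begin

text \<open>
  Signals are functions of type \<^typ>\<open>nat \<Rightarrow> real\<close>. The subtraction \<open>k - i\<close> below is truncated, so
  the definitions have their intended meaning when \<open>n \<le> k + 1\<close>.
\<close>

text \<open>
  A vector of dimension \<open>n\<close> is a function on the index set \<open>{..<n}\<close>; its Euclidean norm is
  \<^const>\<open>L2_set\<close> over that index set.
\<close>

definition window :: "nat \<Rightarrow> (nat \<Rightarrow> real) \<Rightarrow> nat \<Rightarrow> nat \<Rightarrow> real"
  where "window n x k = (\<lambda>i\<in>{..<n}. x (k - i))"

definition window_norm :: "nat \<Rightarrow> (nat \<Rightarrow> real) \<Rightarrow> nat \<Rightarrow> real"
  where "window_norm n x k = L2_set (window n x k) {..<n}"

definition window_mean :: "nat \<Rightarrow> (nat \<Rightarrow> real) \<Rightarrow> nat \<Rightarrow> real"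
  where "window_mean n x k = (1 / real n) * (\<Sum>i<n. x (k - i))"

definition window_sd :: "nat \<Rightarrow> (nat \<Rightarrow> real) \<Rightarrow> nat \<Rightarrow> real"
  where "window_sd n x k =
    sqrt ((1 / real n) * (\<Sum>i<n. (x (k - i))\<^sup>2) - (window_mean n x k)\<^sup>2)"

text \<open>
  \<^const>\<open>window_sd\<close> is the nonnegative number whose square is the windowed variance: the
  radicand is never negative.
\<close>

lemma window_sd_radicand_nonneg:
  "0 \<le> (1 / real n) * (\<Sum>i<n. (x (k - i))\<^sup>2) - (window_mean n x k)\<^sup>2"
proof (cases "n = 0")
  case False
  have "(\<Sum>i<n. x (k - i))\<^sup>2 \<le> (\<Sum>i<n. (x (k - i))\<^sup>2) * real n"
    using sum_squared_le_sum_of_squares[of "\<lambda>i. x (k - i)" "{..<n}"] by simp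
  with False show ?thesis
    by (simp add: window_mean_def power2_eq_square field_simps)
qed (simp add: window_mean_def)

lemma window_sd_nonneg: "0 \<le> window_sd n x k"
  using window_sd_radicand_nonneg[of n x k] by (simp add: window_sd_def)

lemma window_sd_squared:
  "(window_sd n x k)\<^sup>2 = (1 / real n) * (\<Sum>i<n. (x (k - i))\<^sup>2) - (window_mean n x k)\<^sup>2"
  using window_sd_radicand_nonneg[of n x k] by (simp add: window_sd_def)

end

theory Submission
  imports Defs
begin

text \<open>
  Up to the factor \<open>\<surd>n\<close>, the windowed standard deviation is the Euclidean norm of the centred
  window, hence a seminorm on signals that vanishes on constants. The difference of variances is
  twice a covariance, and in a covariance only one factor needs to be centred, so Cauchy--Schwarz
  gives the first bound. For the second, write \<open>a = \<mu>[a] + u\<close> and \<open>b = \<mu>[b] + v\<close>; then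
  \<open>a b = u v + \<mu>[a] b + \<mu>[b] a - \<mu>[a] \<mu>[b]\<close>, and the seminorm of \<open>u v\<close> is at most its root mean
  square.
\<close>

lemma window_norm_eq: "window_norm n x k = L2_set (\<lambda>i. x (k - i)) {..<n}"
  unfolding window_norm_def window_def by (rule L2_set_cong) auto

lemma window_norm_nonneg: "0 \<le> window_norm n x k"
  by (simp add: window_norm_def)

lemma window_norm_squared: "(window_norm n x k)\<^sup>2 = (\<Sum>i<n. (x (k - i))\<^sup>2)"
  by (simp add: window_norm_eq L2_set_def sum_nonneg)

lemma sum_window: "(\<Sum>i<n. x (k - i)) = real n * window_mean n x k"
  by (cases "n = 0") (simp_all add: window_mean_def)

lemma sum_centred_window_squared:
  "(\<Sum>i<n. (x (k - i) - window_mean n x k)\<^sup>2) = real n * (window_sd n x k)\<^sup>2"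
proof (cases "n = 0")
  case False
  have "(\<Sum>i<n. (x (k - i) - window_mean n x k)\<^sup>2)
      = (\<Sum>i<n. (x (k - i))\<^sup>2) - 2 * window_mean n x k * (\<Sum>i<n. x (k - i))
        + real n * (window_mean n x k)\<^sup>2"
    by (simp add: power2_diff sum.distrib sum_subtractf sum_distrib_left algebra_simps)
  also have "\<dots> = real n * (window_sd n x k)\<^sup>2"
    unfolding window_sd_squared sum_window
    using False by (simp add: power2_eq_square field_simps)
  finally show ?thesis .
qed simp

lemma L2_set_centred_window:
  \<comment> \<open>Lets the triangle and Cauchy--Schwarz inequalities for \<open>L2_set\<close> be
    read as statements about \<open>window_sd\<close>.\<close>
  "L2_set (\<lambda>i. x (k - i) - window_mean n x k) {..<n} = sqrt (real n) * window_sd n x k"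
  by (simp add: L2_set_def sum_centred_window_squared real_sqrt_mult window_sd_nonneg)

lemma window_mean_add:
  "window_mean n (\<lambda>j. x j + y j) k = window_mean n x k + window_mean n y k"
  by (simp add: window_mean_def sum.distrib algebra_simps)

lemma window_mean_cmult: "window_mean n (\<lambda>j. c * x j) k = c * window_mean n x k"
  by (simp add: window_mean_def sum_distrib_left[symmetric])

lemma window_mean_const: "n \<ge> 1 \<Longrightarrow> window_mean n (\<lambda>j. c) k = c"
  by (simp add: window_mean_def)

text \<open>Minkowski's inequality for the centred windows: centring is additive because the mean
  is.\<close>

lemma window_sd_add_le:
  "window_sd n (\<lambda>j. x j + y j) k \<le> window_sd n x k + window_sd n y k"
proof (cases "n = 0")
  case False
  have "sqrt (real n) * window_sd n (\<lambda>j. x j + y j) k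
      = L2_set (\<lambda>i. (x (k - i) - window_mean n x k) + (y (k - i) - window_mean n y k)) {..<n}"
    unfolding L2_set_centred_window[symmetric] window_mean_add
    by (rule L2_set_cong) auto
  also have "\<dots> \<le> sqrt (real n) * window_sd n x k + sqrt (real n) * window_sd n y k"
    unfolding L2_set_centred_window[symmetric] by (rule L2_set_triangle_ineq)
  finally have "sqrt (real n) * window_sd n (\<lambda>j. x j + y j) k
      \<le> sqrt (real n) * (window_sd n x k + window_sd n y k)"
    by (simp add: distrib_left)
  with False show ?thesis by simp
qed (simp add: window_sd_def window_mean_def)

lemma window_sd_cmult: "window_sd n (\<lambda>j. c * x j) k = \<bar>c\<bar> * window_sd n x k"
proof -
  have "(window_sd n (\<lambda>j. c * x j) k)\<^sup>2 = (\<bar>c\<bar> * window_sd n x k)\<^sup>2"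
    unfolding power_mult_distrib window_sd_squared window_mean_cmult
    by (simp add: power_mult_distrib sum_distrib_left[symmetric] algebra_simps)
  then show ?thesis
    by (rule power2_eq_imp_eq) (simp_all add: window_sd_nonneg)
qed

lemma window_sd_const: "n \<ge> 1 \<Longrightarrow> window_sd n (\<lambda>j. c) k = 0"
  by (simp add: window_sd_def window_mean_const)

text \<open>Each entry of the window of \<open>x\<close> is at most \<open>window_norm n x k\<close>
  in absolute value, so this norm can be pulled out of the root mean square of the product. The
  bound is meant for centred signals, whose norms are small.\<close>

lemma window_sd_mult_le:
  "window_sd n (\<lambda>j. x j * y j) k \<le> window_norm n x k * window_norm n y k / sqrt (real n)"
proof -
  have "(\<Sum>i<n. (x (k - i) * y (k - i))\<^sup>2) \<le> (\<Sum>i<n. (window_norm n x k)\<^sup>2 * (y (k - i))\<^sup>2)"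
  proof (rule sum_mono)
    fix i assume "i \<in> {..<n}"
    then have "(x (k - i))\<^sup>2 \<le> (window_norm n x k)\<^sup>2"
      unfolding window_norm_squared by (intro member_le_sum) auto
    then show "(x (k - i) * y (k - i))\<^sup>2 \<le> (window_norm n x k)\<^sup>2 * (y (k - i))\<^sup>2"
      by (simp add: power_mult_distrib mult_right_mono)
  qed
  also have "\<dots> = (window_norm n x k * window_norm n y k)\<^sup>2"
    by (simp add: power_mult_distrib window_norm_squared sum_distrib_left)
  finally have "(1 / real n) * (\<Sum>i<n. (x (k - i) * y (k - i))\<^sup>2)
      \<le> (1 / real n) * (window_norm n x k * window_norm n y k)\<^sup>2"
    by (rule mult_left_mono) simp
  \<comment> \<open>Dropping the squared mean from the variance only enlarges it.\<close>
  then have "(window_sd n (\<lambda>j. x j * y j) k)\<^sup>2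
      \<le> (1 / real n) * (window_norm n x k * window_norm n y k)\<^sup>2"
    unfolding window_sd_squared
    using zero_le_power2[of "window_mean n (\<lambda>j. x j * y j) k"] by linarith
  also have "\<dots> = (window_norm n x k * window_norm n y k / sqrt (real n))\<^sup>2"
    by (simp add: power_divide)
  finally show ?thesis
    by (rule power2_le_imp_le) (simp add: window_norm_nonneg)
qed

text \<open>The right side is twice the covariance. The centred window of \<open>y\<close> sums to
  zero, so \<open>x\<close> can stay uncentred; this is what brings in \<open>window_norm\<close> of
  \<open>x\<close> later.\<close>

lemma window_sd_add_squared:
  "(window_sd n (\<lambda>j. x j + y j) k)\<^sup>2 - (window_sd n x k)\<^sup>2 - (window_sd n y k)\<^sup>2
    = 2 / real n * (\<Sum>i<n. x (k - i) * (y (k - i) - window_mean n y k))"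
proof -
  have centred: "(\<Sum>i<n. x (k - i) * (y (k - i) - window_mean n y k))
      = (\<Sum>i<n. x (k - i) * y (k - i)) - real n * window_mean n x k * window_mean n y k"
    by (simp add: right_diff_distrib sum_subtractf sum_window flip: sum_distrib_right)
  have square: "(\<Sum>i<n. (x (k - i) + y (k - i))\<^sup>2)
      = (\<Sum>i<n. (x (k - i))\<^sup>2) + (\<Sum>i<n. (y (k - i))\<^sup>2) + 2 * (\<Sum>i<n. x (k - i) * y (k - i))"
    by (simp add: power2_sum sum.distrib sum_distrib_left mult.assoc)
  show ?thesis
    unfolding window_sd_squared window_mean_add centred square
    \<comment> \<open>For \<open>n = 0\<close> division by zero yields 0, and both sides
      vanish.\<close>
    by (cases "n = 0") (simp_all add: power2_sum field_simps window_mean_def[of 0])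
qed

lemma abs_window_sd_add_squared_le:
  assumes "n \<ge> 1"
  shows "\<bar>(window_sd n (\<lambda>j. x j + y j) k)\<^sup>2 - (window_sd n x k)\<^sup>2 - (window_sd n y k)\<^sup>2\<bar>
    \<le> 2 * (window_norm n x k * window_sd n y k)"
proof -
  have "\<bar>\<Sum>i<n. x (k - i) * (y (k - i) - window_mean n y k)\<bar>
      \<le> (\<Sum>i<n. \<bar>x (k - i)\<bar> * \<bar>y (k - i) - window_mean n y k\<bar>)"
    by (rule order_trans[OF sum_abs]) (simp add: abs_mult)
  also have "\<dots> \<le> window_norm n x k * (sqrt (real n) * window_sd n y k)"
    unfolding window_norm_eq L2_set_centred_window[symmetric] by (rule L2_set_mult_ineq)
  \<comment> \<open>Cauchy--Schwarz alone would give the sharper factor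
    \<open>2 / sqrt (real n)\<close>. Replacing \<open>sqrt (real n)\<close> by
    \<open>real n\<close> lets the prefactor \<open>2 / real n\<close> cancel to 2.\<close>
  also have "\<dots> \<le> window_norm n x k * (real n * window_sd n y k)"
    using assms
    by (intro mult_left_mono mult_right_mono window_norm_nonneg window_sd_nonneg)
      (simp add: sqrt_le_D real_le_lsqrt power2_eq_square)
  finally have "2 / real n * \<bar>\<Sum>i<n. x (k - i) * (y (k - i) - window_mean n y k)\<bar>
      \<le> 2 / real n * (window_norm n x k * (real n * window_sd n y k))"
    by (rule mult_left_mono) simp
  with assms show ?thesis
    unfolding window_sd_add_squared abs_mult by simp
qed

lemma window_sd_mult_le_means:
  assumes "n \<ge> 1"
  shows "window_sd n (\<lambda>j. x j * y j) k
    \<le> sqrt (real n) * window_sd n x k * window_sd n y k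
      + \<bar>window_mean n x k\<bar> * window_sd n y k + \<bar>window_mean n y k\<bar> * window_sd n x k"
proof -
  \<comment> \<open>\<open>p\<close> and \<open>q\<close> are the means at the fixed time
    \<open>k\<close>, so \<open>u\<close> and \<open>v\<close> differ from \<open>x\<close> and
    \<open>y\<close> by constants, not by moving averages.\<close>
  define p where "p = window_mean n x k"
  define q where "q = window_mean n y k"
  define u where "u = (\<lambda>j. x j - p)"
  define v where "v = (\<lambda>j. y j - q)"
  have "window_norm n u k = sqrt (real n) * window_sd n x k"
    "window_norm n v k = sqrt (real n) * window_sd n y k"
    by (simp_all add: window_norm_eq u_def v_def p_def q_def L2_set_centred_window)
  \<comment> \<open>The two norms contribute \<open>sqrt (real n)\<close> each, and the division in
    \<open>window_sd_mult_le\<close> removes one of them.\<close>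
  then have uv: "window_sd n (\<lambda>j. u j * v j) k \<le> sqrt (real n) * window_sd n x k * window_sd n y k"
    using window_sd_mult_le[of n u v k] assms by (simp add: mult_ac)
  \<comment> \<open>With \<open>p\<close> and \<open>q\<close> constant, every summand after
    \<open>u j * v j\<close> is a scaled signal or a constant, so the seminorm properties apply to
    it.\<close>
  have split: "(\<lambda>j. x j * y j) = (\<lambda>j. ((u j * v j + p * y j) + q * x j) + - (p * q))"
    by (simp add: u_def v_def algebra_simps)
  have "window_sd n (\<lambda>j. x j * y j) k \<le> window_sd n (\<lambda>j. u j * v j) k
      + window_sd n (\<lambda>j. p * y j) k + window_sd n (\<lambda>j. q * x j) k + window_sd n (\<lambda>j. - (p * q)) k"
    unfolding split by (intro order_trans[OF window_sd_add_le] add_mono order_refl)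
  with uv show ?thesis
    unfolding window_sd_cmult window_sd_const[OF assms] p_def q_def by linarith
qed

theorem lemma4p1:
  fixes a b :: "nat \<Rightarrow> real" and n k :: nat
  assumes "n \<ge> 1" and "k \<ge> n - 1"
  shows
    "\<bar>(window_sd n (\<lambda>j. a j + b j) k)\<^sup>2 - (window_sd n a k)\<^sup>2 - (window_sd n b k)\<^sup>2\<bar>
       \<le> 2 * min (window_norm n a k * window_sd n b k) (window_norm n b k * window_sd n a k)
     \<and> window_sd n (\<lambda>j. a j * b j) k
       \<le> sqrt (real n) * window_sd n a k * window_sd n b k
          + \<bar>window_mean n a k\<bar> * window_sd n b k
          + \<bar>window_mean n b k\<bar> * window_sd n a k"
  \<comment> \<open>The difference of variances is symmetric in \<open>a\<close> and
    \<open>b\<close>; exchanging their roles gives the second argument of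
    \<open>min\<close>.\<close>
  using abs_window_sd_add_squared_le[OF assms(1), of a b k]
    abs_window_sd_add_squared_le[OF assms(1), of b a k]
    window_sd_mult_le_means[OF assms(1), of a b k]
  by (simp add: min_def add.commute algebra_simps)

end
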